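(* Let $\Lambda$ be a finite-dimensional basic split $k$-algebra with Jacobson radical $J$ satisfying $J^n=0$. Let $e_i,e_j$ be primitive idempotents and set $V_{ij}=e_jJ^{n-1}e_i$. Assume $V_{ij}\neq 0$, and set $m_{ij}=\dim_kV_{ij}$. Then there is a natural bijection $\mathcal F^{<n,\mathrm{top}}_{ij}\cong\mathbb P_k(V_{ij}^* )$. Consequently, after choosing a basis of $V_{ij}$, there is a noncanonical bijection $\mathcal F^{<n,\mathrm{top}}_{ij}\cong\mathbb P_k^{\,m_{ij}-1}$.
   Context: $k$ is a field; modules are finite-dimensional left $\Lambda$-modules, $n\ge 1$, $J^0=\Lambda$. Fix a complete set $e_1,\dots,e_t$ of primitive orthogonal idempotents of $\Lambda$, with $e_i,e_j$ among them; $\Lambda$ basic means the modules $\Lambda e_h$ are pairwise non-isomorphic, and split means $e_h\Lambda e_h/e_hJe_h\cong k$ for every $h$. $V_{ij}^*=\operatorname{Hom}_k(V_{ij},k)$, and $\mathbb P_k(X)$ denotes the set of one-dimensional subspaces of a $k$-vector space $X$, with $\mathbb P_k^{m-1}=\mathbb P_k(k^m)$. Put $P_i=\Lambda e_i$ and $W_j=\bigoplus_{h\ne j}e_hJ^{n-1}P_i$. For $0\ne\lambda\in V_{ij}^*$ put $K_\lambda=W_j\oplus\ker\lambda\subseteq J^{n-1}P_i$ (a $\Lambda$-submodule of $P_i$) and $M_\lambda=P_i/K_\lambda$. The (rank-one) terminal ambiguity fibre $\mathcal F^{<n,\mathrm{top}}_{ij}$ is the set of isomorphism classes of the $\Lambda$-modules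 $M_\lambda$, $0\neq\lambda\in V_{ij}^*$. *)

theory Defs
  imports Complex_Main "HOL-Library.Function_Algebras" "HOL-Library.Set_Algebras"
begin

locale fd_algebra = vector_space scale
  for scale :: "'k::field \<Rightarrow> 'a::ring_1 \<Rightarrow> 'a" +
  assumes scale_mult_left: "scale c (x * y) = scale c x * y"
    and scale_mult_right: "scale c (x * y) = x * scale c y"
    and finite_dim: "\<exists>B. finite B \<and> span B = UNIV"

definition left_ideal :: "'a::ring_1 set \<Rightarrow> bool" where
  "left_ideal I \<longleftrightarrow> 0 \<in> I \<and> (\<forall>x\<in>I. \<forall>y\<in>I. x + y \<in> I) \<and> (\<forall>r. \<forall>x\<in>I. r * x \<in> I)"

definition maximal_left_ideal :: "'a::ring_1 set \<Rightarrow> bool" where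
  "maximal_left_ideal I \<longleftrightarrow> left_ideal I \<and> I \<noteq> UNIV \<and>
     (\<forall>I'. left_ideal I' \<and> I \<subseteq> I' \<longrightarrow> I' = I \<or> I' = UNIV)"

definition jacobson_radical :: "'a::ring_1 set" where
  "jacobson_radical = \<Inter>{I. maximal_left_ideal I}"

text \<open>The product of ideals (or of an ideal with a left ideal, viewed as a module) consists of
  finite sums of products; the product \<open>A * B\<close> of \<^theory>\<open>HOL-Library.Set_Algebras\<close> is only the
  set of products.\<close>

definition ideal_prod :: "'a::ring_1 set \<Rightarrow> 'a set \<Rightarrow> 'a set" where
  "ideal_prod A B = {\<Sum>l<N. a l * b l | (N::nat) a b. \<forall>l<N. a l \<in> A \<and> b l \<in> B}"

fun ideal_pow :: "'a::ring_1 set \<Rightarrow> nat \<Rightarrow> 'a set" where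
  "ideal_pow I 0 = UNIV"
| "ideal_pow I (Suc n) = ideal_prod I (ideal_pow I n)"

definition left_principal :: "'a::ring_1 \<Rightarrow> 'a set" where
  "left_principal x = {r * x | r. True}"

definition primitive_idempotent :: "'a::ring_1 \<Rightarrow> bool" where
  "primitive_idempotent x \<longleftrightarrow> x * x = x \<and> x \<noteq> 0 \<and>
     (\<nexists>f g. f * f = f \<and> g * g = g \<and> f * g = 0 \<and> g * f = 0 \<and> f \<noteq> 0 \<and> g \<noteq> 0 \<and> x = f + g)"

definition complete_primitive_orthogonal :: "(nat \<Rightarrow> 'a::ring_1) \<Rightarrow> nat \<Rightarrow> bool" where
  "complete_primitive_orthogonal e t \<longleftrightarrow>
     (\<forall>h\<in>{1..t}. primitive_idempotent (e h)) \<and>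
     (\<forall>h\<in>{1..t}. \<forall>l\<in>{1..t}. h \<noteq> l \<longrightarrow> e h * e l = 0) \<and>
     (\<Sum>h\<in>{1..t}. e h) = 1"

record ('r, 'm) lmod =
  mcarrier :: "'m set"
  madd :: "'m \<Rightarrow> 'm \<Rightarrow> 'm"
  mzero :: "'m"
  mact :: "'r \<Rightarrow> 'm \<Rightarrow> 'm"

definition left_module :: "('r::ring_1, 'm) lmod \<Rightarrow> bool" where
  "left_module M \<longleftrightarrow>
     mzero M \<in> mcarrier M \<and>
     (\<forall>x\<in>mcarrier M. \<forall>y\<in>mcarrier M. madd M x y \<in> mcarrier M) \<and>
     (\<forall>x\<in>mcarrier M. \<forall>y\<in>mcarrier M. \<forall>z\<in>mcarrier M.
        madd M (madd M x y) z = madd M x (madd M y z)) \<and>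
     (\<forall>x\<in>mcarrier M. \<forall>y\<in>mcarrier M. madd M x y = madd M y x) \<and>
     (\<forall>x\<in>mcarrier M. madd M (mzero M) x = x) \<and>
     (\<forall>x\<in>mcarrier M. \<exists>y\<in>mcarrier M. madd M y x = mzero M) \<and>
     (\<forall>r. \<forall>x\<in>mcarrier M. mact M r x \<in> mcarrier M) \<and>
     (\<forall>r. \<forall>x\<in>mcarrier M. \<forall>y\<in>mcarrier M.
        mact M r (madd M x y) = madd M (mact M r x) (mact M r y)) \<and>
     (\<forall>r s. \<forall>x\<in>mcarrier M. mact M (r + s) x = madd M (mact M r x) (mact M s x)) \<and>
     (\<forall>r s. \<forall>x\<in>mcarrier M. mact M (r * s) x = mact M r (mact M s x)) \<and>
     (\<forall>x\<in>mcarrier M. mact M 1 x = x)"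

definition module_isomorphic :: "('r::ring_1, 'm) lmod \<Rightarrow> ('r, 'n) lmod \<Rightarrow> bool" where
  "module_isomorphic M N \<longleftrightarrow>
     (\<exists>f. bij_betw f (mcarrier M) (mcarrier N) \<and>
          (\<forall>x\<in>mcarrier M. \<forall>y\<in>mcarrier M. f (madd M x y) = madd N (f x) (f y)) \<and>
          (\<forall>r. \<forall>x\<in>mcarrier M. f (mact M r x) = mact N r (f x)))"

text \<open>The isomorphism class of \<open>M\<close> among all modules with elements in the same HOL type as those
  of \<open>M\<close>.  Modules isomorphic to a finite-dimensional one are finite-dimensional, so no
  dimension condition is imposed on \<open>N\<close>.\<close>

definition iso_class :: "('r::ring_1, 'm) lmod \<Rightarrow> ('r, 'm) lmod set" where
  "iso_class M = {N. left_module N \<and> module_isomorphic M N}"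

definition left_ideal_module :: "'a::ring_1 set \<Rightarrow> ('a, 'a) lmod" where
  "left_ideal_module P = \<lparr>mcarrier = P, madd = (+), mzero = 0, mact = (*)\<rparr>"

text \<open>\<open>P / K\<close>, with cosets \<open>x + K\<close> as elements.  In terms of sets,
  \<open>(x + K) + (y + K) = (x + y) + K\<close> and \<open>r (x + K) + K = r x + K\<close>; the summand \<open>K\<close> in the
  action is needed because \<open>r K\<close> may be a proper subset of \<open>K\<close>.\<close>

definition quotient_module :: "'a::ring_1 set \<Rightarrow> 'a set \<Rightarrow> ('a, 'a set) lmod" where
  "quotient_module P K =
     \<lparr>mcarrier = {x +o K | x. x \<in> P}, madd = (+), mzero = K, mact = (\<lambda>r A. (r *o A) + K)\<rparr>"

definition basic_algebra :: "(nat \<Rightarrow> 'a::ring_1) \<Rightarrow> nat \<Rightarrow> bool" where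
  "basic_algebra e t \<longleftrightarrow>
     (\<forall>h\<in>{1..t}. \<forall>l\<in>{1..t}. h \<noteq> l \<longrightarrow>
        \<not> module_isomorphic (left_ideal_module (left_principal (e h)))
                            (left_ideal_module (left_principal (e l))))"

text \<open>\<open>peirce x A y\<close> is \<open>x A y\<close>, for subsets \<open>A\<close> closed under addition.\<close>

definition peirce :: "'a::ring_1 \<Rightarrow> 'a set \<Rightarrow> 'a \<Rightarrow> 'a set" where
  "peirce x A y = {x * a * y | a. a \<in> A}"

text \<open>For an idempotent \<open>x\<close>, the map \<open>\<phi>\<close> below is an isomorphism of \<open>k\<close>-algebras from
  \<open>x \<Lambda> x / x J x\<close>, whose elements are the cosets \<open>a + x J x\<close> and whose unit is the coset of \<open>x\<close>,
  onto \<open>k\<close>; its compatibility with the operations is expressed on representatives.\<close>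

definition split_idempotent :: "('k::field \<Rightarrow> 'a::ring_1 \<Rightarrow> 'a) \<Rightarrow> 'a \<Rightarrow> bool" where
  "split_idempotent scale x \<longleftrightarrow>
     (let C = peirce x UNIV x; I = peirce x jacobson_radical x in
      \<exists>\<phi> :: 'a set \<Rightarrow> 'k.
        bij_betw \<phi> {a +o I | a. a \<in> C} UNIV \<and>
        (\<forall>a\<in>C. \<forall>b\<in>C. \<phi> ((a + b) +o I) = \<phi> (a +o I) + \<phi> (b +o I)) \<and>
        (\<forall>a\<in>C. \<forall>b\<in>C. \<phi> ((a * b) +o I) = \<phi> (a +o I) * \<phi> (b +o I)) \<and>
        (\<forall>c. \<forall>a\<in>C. \<phi> (scale c a +o I) = c * \<phi> (a +o I)) \<and>
        \<phi> (x +o I) = 1)"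

definition split_algebra :: "('k::field \<Rightarrow> 'a::ring_1 \<Rightarrow> 'a) \<Rightarrow> (nat \<Rightarrow> 'a) \<Rightarrow> nat \<Rightarrow> bool" where
  "split_algebra scale e t \<longleftrightarrow> (\<forall>h\<in>{1..t}. split_idempotent scale (e h))"

definition fun_scale :: "'k::field \<Rightarrow> ('b \<Rightarrow> 'k) \<Rightarrow> 'b \<Rightarrow> 'k" where
  "fun_scale c f = (\<lambda>x. c * f x)"

interpretation fun_space: vector_space "fun_scale :: 'k::field \<Rightarrow> ('b \<Rightarrow> 'k) \<Rightarrow> 'b \<Rightarrow> 'k"
  by unfold_locales (auto simp: fun_scale_def fun_eq_iff algebra_simps)

text \<open>\<open>X\<close> is a subspace of a space of functions with pointwise operations; the dual space and
  \<open>k\<^sup>m\<close> are both realised in this way.\<close>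

definition proj_space :: "('b \<Rightarrow> 'k::field) set \<Rightarrow> ('b \<Rightarrow> 'k) set set" where
  "proj_space X = {L. L \<subseteq> X \<and> fun_space.subspace L \<and> fun_space.dim L = 1}"

text \<open>Linear functionals on a subspace \<open>V\<close>; each is represented by its extension by \<open>0\<close> outside \<open>V\<close>,
  so that equality of functionals on \<open>V\<close> is equality of functions.\<close>

definition dual_space :: "('k::field \<Rightarrow> 'a::ab_group_add \<Rightarrow> 'a) \<Rightarrow> 'a set \<Rightarrow> ('a \<Rightarrow> 'k) set" where
  "dual_space scale V = {\<phi>.
     (\<forall>x\<in>V. \<forall>y\<in>V. \<phi> (x + y) = \<phi> x + \<phi> y) \<and>
     (\<forall>c. \<forall>x\<in>V. \<phi> (scale c x) = c * \<phi> x) \<and>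
     (\<forall>x. x \<notin> V \<longrightarrow> \<phi> x = 0)}"

definition coord_space :: "nat \<Rightarrow> (nat \<Rightarrow> 'k::field) set" where
  "coord_space m = {v. \<forall>l\<ge>m. v l = 0}"

definition dual_coords :: "nat \<Rightarrow> (nat \<Rightarrow> 'a) \<Rightarrow> ('a \<Rightarrow> 'k::field) \<Rightarrow> nat \<Rightarrow> 'k" where
  "dual_coords m b \<phi> = (\<lambda>l. if l < m then \<phi> (b l) else 0)"

definition is_basis :: "('k::field \<Rightarrow> 'a::ab_group_add \<Rightarrow> 'a) \<Rightarrow> 'a set \<Rightarrow> nat \<Rightarrow> (nat \<Rightarrow> 'a) \<Rightarrow> bool" where
  "is_basis scale V m b \<longleftrightarrow>
     inj_on b {..<m} \<and> \<not> module.dependent scale (b ` {..<m}) \<and> module.span scale (b ` {..<m}) = V"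

text \<open>With \<open>P\<^sub>i = \<Lambda> e\<^sub>i\<close>: \<open>V_space\<close> is \<open>V\<^sub>i\<^sub>j = e\<^sub>j J\<^bsup>n-1\<^esup> e\<^sub>i\<close>, \<open>top_layer\<close> is \<open>J\<^bsup>n-1\<^esup> P\<^sub>i\<close>, and \<open>W_space\<close> is the
  internal sum of the \<open>e\<^sub>h J\<^bsup>n-1\<^esup> P\<^sub>i\<close> over \<open>h \<noteq> j\<close>.  This sum, and the sum with the kernel in
  \<open>K_submodule\<close>, are direct because the \<open>e\<^sub>h\<close> are orthogonal.\<close>

definition V_space :: "(nat \<Rightarrow> 'a::ring_1) \<Rightarrow> nat \<Rightarrow> nat \<Rightarrow> nat \<Rightarrow> 'a set" where
  "V_space e n i j = peirce (e j) (ideal_pow jacobson_radical (n - 1)) (e i)"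

definition top_layer :: "(nat \<Rightarrow> 'a::ring_1) \<Rightarrow> nat \<Rightarrow> nat \<Rightarrow> 'a set" where
  "top_layer e n i = ideal_prod (ideal_pow jacobson_radical (n - 1)) (left_principal (e i))"

definition W_space :: "(nat \<Rightarrow> 'a::ring_1) \<Rightarrow> nat \<Rightarrow> nat \<Rightarrow> nat \<Rightarrow> nat \<Rightarrow> 'a set" where
  "W_space e t n i j =
     {\<Sum>h\<in>{1..t} - {j}. w h | w. \<forall>h\<in>{1..t} - {j}. w h \<in> e h *o top_layer e n i}"

definition K_submodule ::
  "(nat \<Rightarrow> 'a::ring_1) \<Rightarrow> nat \<Rightarrow> nat \<Rightarrow> nat \<Rightarrow> nat \<Rightarrow> ('a \<Rightarrow> 'k::field) \<Rightarrow> 'a set" where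
  "K_submodule e t n i j \<phi> = W_space e t n i j + {v \<in> V_space e n i j. \<phi> v = 0}"

definition M_module ::
  "(nat \<Rightarrow> 'a::ring_1) \<Rightarrow> nat \<Rightarrow> nat \<Rightarrow> nat \<Rightarrow> nat \<Rightarrow> ('a \<Rightarrow> 'k::field) \<Rightarrow> ('a, 'a set) lmod" where
  "M_module e t n i j \<phi> = quotient_module (left_principal (e i)) (K_submodule e t n i j \<phi>)"

definition terminal_fibre ::
  "('k::field \<Rightarrow> 'a::ring_1 \<Rightarrow> 'a) \<Rightarrow> (nat \<Rightarrow> 'a) \<Rightarrow> nat \<Rightarrow> nat \<Rightarrow> nat \<Rightarrow> nat \<Rightarrow>
     ('a, 'a set) lmod set set" where
  "terminal_fibre scale e t n i j =
     {iso_class (M_module e t n i j \<phi>) | \<phi>. \<phi> \<in> dual_space scale (V_space e n i j) \<and> \<phi> \<noteq> 0}"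

end

theory Submission
  imports Defs
begin

text \<open>
  Write \<open>T = J\<^bsup>n-1\<^esup> P\<^sub>i\<close> and \<open>V = e\<^sub>j T\<close>.  Everything rests on \<open>J\<close> annihilating the last power \<open>J\<^bsup>n-1\<^esup>\<close>
  from both sides, because \<open>J\<^sup>n = 0\<close>.

  On the left, \<open>\<Lambda>\<close> acts on \<open>T\<close> through \<open>\<Lambda> / J\<close>.  As \<open>\<Lambda>\<close> is basic, \<open>e\<^sub>j \<Lambda> e\<^sub>h \<subseteq> J\<close> for \<open>h \<noteq> j\<close>
  (\<open>peirce_subset_radical\<close>), and as it is split, \<open>e\<^sub>j \<Lambda> e\<^sub>j\<close> is spanned by \<open>e\<^sub>j\<close> modulo \<open>J\<close>.  So the
  \<open>e\<^sub>j\<close>-component of \<open>r x\<close>, for \<open>x \<in> T\<close>, is a scalar multiple of that of \<open>x\<close>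
  (\<open>e_act_top_layer\<close>).  Therefore \<open>K \<phi> = {x \<in> T. \<phi> (e\<^sub>j x) = 0}\<close> is a submodule of \<open>P\<^sub>i\<close>, and
  \<open>M \<phi>\<close> is a module.

  On the right, an isomorphism \<open>M \<phi> \<rightarrow> M \<psi>\<close> is induced by right multiplication by some
  \<open>y \<in> e\<^sub>i \<Lambda> e\<^sub>i\<close>, that is, by \<open>y = c e\<^sub>i + s\<close> with \<open>c\<close> a scalar and \<open>s \<in> J\<close>.  On \<open>V\<close> it is
  multiplication by \<open>c\<close>, since \<open>V s = 0\<close>, and injectivity together with \<open>\<phi> \<noteq> 0\<close> forces \<open>c \<noteq> 0\<close>.
  So \<open>\<phi>\<close> and \<open>\<psi>\<close> have the same kernel in \<open>V\<close> (\<open>M_module_isomorphic_imp_kernel_eq\<close>), which makes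
  them proportional.  Conversely, proportional functionals define the same \<open>K\<close>, hence the same
  module.  Thus the isomorphism class of \<open>M \<phi>\<close> and the line spanned by \<open>\<phi>\<close> determine each other
  (\<open>iso_class_M_module_eq_iff\<close>).  A basis of \<open>V\<close> identifies its dual space linearly with the
  coordinate space, and a linear bijection carries lines to lines.
\<close>

section \<open>Left ideals, the radical and its powers\<close>

lemma left_ideal_zero: "left_ideal I \<Longrightarrow> 0 \<in> I"
  and left_ideal_add: "left_ideal I \<Longrightarrow> x \<in> I \<Longrightarrow> y \<in> I \<Longrightarrow> x + y \<in> I"
  and left_ideal_mult: "left_ideal I \<Longrightarrow> x \<in> I \<Longrightarrow> r * x \<in> I"
  by (auto simp: left_ideal_def)

lemma left_ideal_uminus: "left_ideal I \<Longrightarrow> x \<in> I \<Longrightarrow> - x \<in> I"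
  using left_ideal_mult[of I x "-1"] by simp

lemma left_ideal_sum: "left_ideal I \<Longrightarrow> (\<And>l. l \<in> S \<Longrightarrow> f l \<in> I) \<Longrightarrow> sum f S \<in> I"
  by (induction S rule: infinite_finite_induct) (auto intro: left_ideal_zero left_ideal_add)

lemma left_ideal_eq_UNIV: "left_ideal I \<Longrightarrow> 1 \<in> I \<Longrightarrow> I = UNIV"
  using left_ideal_mult[of I 1 r for r] by (simp add: set_eq_iff)

lemma left_ideal_left_principal: "left_ideal (left_principal x)"
proof -
  have eq: "left_principal x = range (\<lambda>r. r * x)" unfolding left_principal_def by blast
  have "0 \<in> left_principal x" unfolding eq by (rule range_eqI[of _ _ 0]) simp
  moreover have "r * x + s * x \<in> left_principal x" for r s
    unfolding eq by (rule range_eqI[of _ _ "r + s"]) (rule distrib_right[symmetric])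
  moreover have "r * (s * x) \<in> left_principal x" for r s
    unfolding eq by (rule range_eqI[of _ _ "r * s"]) (rule mult.assoc[symmetric])
  ultimately show ?thesis unfolding left_ideal_def by (auto simp: eq)
qed

lemma left_ideal_Inter: "(\<And>I. I \<in> \<I> \<Longrightarrow> left_ideal I) \<Longrightarrow> left_ideal (\<Inter>\<I>)"
  by (simp add: left_ideal_def)

lemma left_ideal_jacobson_radical: "left_ideal jacobson_radical"
  unfolding jacobson_radical_def
  by (rule left_ideal_Inter) (simp add: maximal_left_ideal_def)

lemma jacobson_radical_subset: "maximal_left_ideal I \<Longrightarrow> x \<in> jacobson_radical \<Longrightarrow> x \<in> I"
  unfolding jacobson_radical_def by blast

text \<open>Right multiplication by \<open>x\<close> followed by reduction modulo \<open>I\<close> maps \<open>A\<close> onto a submodule of the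
  simple module \<open>\<Lambda> / I\<close>, so its image is everything as soon as it is nonzero.\<close>

lemma maximal_left_ideal_right_mult_onto:
  assumes I: "maximal_left_ideal I" and A: "left_ideal A" and z: "z \<in> A" "z * x \<notin> I"
  obtains y where "y \<in> A" "u - y * x \<in> I"
proof -
  have lI: "left_ideal I" using I by (simp add: maximal_left_ideal_def)
  define Q where "Q = {y * x + w | y w. y \<in> A \<and> w \<in> I}"
  have "left_ideal Q"
    unfolding left_ideal_def
  proof (intro conjI ballI allI)
    show "0 \<in> Q" unfolding Q_def
      using left_ideal_zero[OF lI] left_ideal_zero[OF A] by force
    show "a + b \<in> Q" if ab: "a \<in> Q" "b \<in> Q" for a b
    proof -
      obtain y w y' w' where
        "y \<in> A" "w \<in> I" "a = y * x + w" "y' \<in> A" "w' \<in> I" "b = y' * x + w'"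
        using ab unfolding Q_def by blast
      then have "a + b = (y + y') * x + (w + w')" "y + y' \<in> A" "w + w' \<in> I"
        using lI A by (auto simp: algebra_simps left_ideal_add)
      then show ?thesis unfolding Q_def by blast
    qed
    show "r * a \<in> Q" if a: "a \<in> Q" for r a
    proof -
      obtain y w where "y \<in> A" "w \<in> I" "a = y * x + w"
        using a unfolding Q_def by blast
      then have "r * a = (r * y) * x + r * w" "r * y \<in> A" "r * w \<in> I"
        using lI A by (auto simp: algebra_simps left_ideal_mult)
      then show ?thesis unfolding Q_def by blast
    qed
  qed
  moreover have "I \<subseteq> Q"
    unfolding Q_def using left_ideal_zero[OF A] by force
  moreover have "z * x \<in> Q"
    unfolding Q_def using left_ideal_zero[OF lI] z(1) by force
  ultimately have "Q = UNIV"
    using I z(2) unfolding maximal_left_ideal_def by blast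
  then obtain y w where "y \<in> A" "w \<in> I" "u = y * x + w"
    unfolding Q_def by blast
  then show thesis using that[of y] by simp
qed

text \<open>If \<open>x \<notin> I\<close>, right multiplication by \<open>x\<close> identifies \<open>\<Lambda>\<close> modulo the set below with the simple
  module \<open>\<Lambda> / I\<close>.  This is what makes the intersection of the maximal left ideals a right ideal.\<close>

lemma maximal_left_ideal_colon:
  assumes I: "maximal_left_ideal I" and x: "x \<notin> I"
  shows "maximal_left_ideal {y. y * x \<in> I}"
proof -
  have lI: "left_ideal I" using I by (simp add: maximal_left_ideal_def)
  have lC: "left_ideal {y. y * x \<in> I}"
    using lI by (auto simp: left_ideal_def distrib_right mult.assoc)
  have "I' = {y. y * x \<in> I} \<or> I' = UNIV"
    if lI': "left_ideal I'" and sub: "{y. y * x \<in> I} \<subseteq> I'" for I'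
  proof (cases "I' = {y. y * x \<in> I}")
    case False
    then obtain z where z: "z \<in> I'" "z * x \<notin> I" using sub by blast
    obtain y where y: "y \<in> I'" "x - y * x \<in> I"
      using maximal_left_ideal_right_mult_onto[OF I lI' z] .
    then have "1 - y \<in> I'" using sub by (auto simp: left_diff_distrib)
    then have "1 \<in> I'" using left_ideal_add[OF lI' _ y(1), of "1 - y"] by simp
    then show ?thesis using left_ideal_eq_UNIV[OF lI'] by simp
  qed simp
  moreover have "{y. y * x \<in> I} \<noteq> UNIV"
    using x by (metis UNIV_I mem_Collect_eq mult_1)
  ultimately show ?thesis
    using lC unfolding maximal_left_ideal_def by blast
qed

lemma jacobson_radical_mult_right:
  assumes x: "x \<in> jacobson_radical"
  shows "x * r \<in> jacobson_radical"
proof -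
  have "x * r \<in> I" if I: "maximal_left_ideal I" for I
  proof (cases "r \<in> I")
    case True
    then show ?thesis using I by (auto simp: maximal_left_ideal_def left_ideal_mult)
  next
    case False
    then show ?thesis
      using jacobson_radical_subset[OF maximal_left_ideal_colon[OF I False] x] by simp
  qed
  then show ?thesis unfolding jacobson_radical_def by blast
qed

lemma ideal_prod_induct [consumes 1, case_names zero add mult]:
  assumes "x \<in> ideal_prod A B"
    and "P 0"
    and "\<And>x y. P x \<Longrightarrow> P y \<Longrightarrow> P (x + y)"
    and "\<And>a b. a \<in> A \<Longrightarrow> b \<in> B \<Longrightarrow> P (a * b)"
  shows "P x"
proof -
  obtain N a b where x: "x = (\<Sum>l<(N::nat). a l * b l)" and ab: "\<forall>l<N. a l \<in> A \<and> b l \<in> B"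
    using assms(1) unfolding ideal_prod_def by blast
  have "P (\<Sum>l<M. a l * b l)" if "M \<le> N" for M
    using that by (induction M) (use assms(2-4) ab in auto)
  then show ?thesis using x by simp
qed

lemma ideal_prod_zero: "0 \<in> ideal_prod A B"
  unfolding ideal_prod_def by (auto intro!: exI[of _ "0::nat"])

lemma ideal_prod_add_mult:
  assumes "x \<in> ideal_prod A B" "a \<in> A" "b \<in> B"
  shows "x + a * b \<in> ideal_prod A B"
proof -
  obtain N f g where x: "x = (\<Sum>l<(N::nat). f l * g l)" and fg: "\<forall>l<N. f l \<in> A \<and> g l \<in> B"
    using assms(1) unfolding ideal_prod_def by blast
  have "x + a * b = (\<Sum>l<Suc N. (f(N := a)) l * (g(N := b)) l)"
    by (simp add: x)
  moreover have "\<forall>l<Suc N. (f(N := a)) l \<in> A \<and> (g(N := b)) l \<in> B"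
    using fg assms(2,3) by (auto simp: less_Suc_eq)
  ultimately show ?thesis unfolding ideal_prod_def by blast
qed

lemma ideal_prod_mult: "a \<in> A \<Longrightarrow> b \<in> B \<Longrightarrow> a * b \<in> ideal_prod A B"
  using ideal_prod_add_mult[OF ideal_prod_zero] by simp

lemma ideal_prod_add:
  assumes "x \<in> ideal_prod A B" "y \<in> ideal_prod A B"
  shows "x + y \<in> ideal_prod A B"
proof -
  obtain N a b where y: "y = (\<Sum>l<(N::nat). a l * b l)" and ab: "\<forall>l<N. a l \<in> A \<and> b l \<in> B"
    using assms(2) unfolding ideal_prod_def by blast
  have "x + (\<Sum>l<M. a l * b l) \<in> ideal_prod A B" if "M \<le> N" for M
    using that
    by (induction M) (use assms(1) ab in \<open>auto simp: add.assoc[symmetric] intro: ideal_prod_add_mult\<close>)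
  then show ?thesis using y by simp
qed

lemma left_ideal_ideal_prod:
  assumes "left_ideal A"
  shows "left_ideal (ideal_prod A B)"
proof -
  have "r * x \<in> ideal_prod A B" if "x \<in> ideal_prod A B" for r x
    using that
  proof (induction rule: ideal_prod_induct)
    case (mult a b)
    have "(r * a) * b \<in> ideal_prod A B"
      using mult assms by (intro ideal_prod_mult left_ideal_mult)
    then show ?case by (simp add: mult.assoc)
  qed (auto simp: ideal_prod_zero distrib_left ideal_prod_add)
  then show ?thesis
    unfolding left_ideal_def using ideal_prod_zero ideal_prod_add by blast
qed

lemma left_ideal_ideal_pow: "left_ideal I \<Longrightarrow> left_ideal (ideal_pow I p)"
  by (cases p) (simp_all add: left_ideal_ideal_prod left_ideal_def[of UNIV])

lemma ideal_pow_mult_right: "x \<in> ideal_pow I p \<Longrightarrow> x * r \<in> ideal_pow I p"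
proof (induction p arbitrary: x)
  case (Suc p)
  from Suc.prems[unfolded ideal_pow.simps] show ?case
    unfolding ideal_pow.simps
  proof (induction rule: ideal_prod_induct)
    case (mult a b)
    then show ?case using Suc.IH by (simp add: mult.assoc ideal_prod_mult)
  qed (auto simp: ideal_prod_zero distrib_right ideal_prod_add)
qed simp

text \<open>The recursion multiplies by \<open>I\<close> on the left, so multiplication by \<open>I\<close> on the right has to be
  moved through the factors.  At the innermost factor \<open>I\<^sup>0 = \<Lambda>\<close> it needs \<open>\<Lambda> I \<subseteq> I\<close>.\<close>

lemma ideal_pow_Suc_right:
  assumes "left_ideal I" "s \<in> I"
  shows "x \<in> ideal_pow I p \<Longrightarrow> x * s \<in> ideal_pow I (Suc p)"
proof (induction p arbitrary: x)
  case 0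
  show ?case
    using ideal_prod_mult[OF left_ideal_mult[OF assms], of 1 UNIV x] by simp
next
  case (Suc p)
  from Suc.prems[unfolded ideal_pow.simps] show ?case
    unfolding ideal_pow.simps(2)[of I "Suc p"]
  proof (induction rule: ideal_prod_induct)
    case (mult a b)
    then show ?case using Suc.IH by (simp add: mult.assoc ideal_prod_mult del: ideal_pow.simps)
  qed (auto simp: ideal_prod_zero distrib_right ideal_prod_add simp del: ideal_pow.simps)
qed

lemma power_in_ideal_pow: "s \<in> I \<Longrightarrow> s ^ p \<in> ideal_pow I p"
  by (induction p) (auto intro: ideal_prod_mult)

text \<open>The inverse is the geometric series in \<open>- s\<close>, which stops because \<open>s\<close> is nilpotent.\<close>

lemma one_plus_left_invertible:
  fixes s :: "'a::ring_1"
  assumes "left_ideal I" "ideal_pow I p = {0}" "s \<in> I"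
  shows "\<exists>u. u * (1 + s) = 1"
proof -
  have "(- s) ^ p = 0"
    using power_in_ideal_pow[OF left_ideal_uminus[OF assms(1,3)], of p] assms(2) by simp
  moreover have "(- s) ^ q * s = s * (- s) ^ q" for q
    using power_commutes[of "- s" q] by simp
  then have "(\<Sum>l<q. (- s) ^ l) * (1 + s) = 1 - (- s) ^ q" for q
    by (induction q) (simp_all add: algebra_simps)
  ultimately have "(\<Sum>l<p. (- s) ^ l) * (1 + s) = 1" by simp
  then show ?thesis ..
qed

section \<open>Split idempotents and basic algebras\<close>

lemma in_peirce_radical:
  "a \<in> peirce x jacobson_radical y \<Longrightarrow> a \<in> jacobson_radical"
  by (auto simp: peirce_def jacobson_radical_mult_right left_ideal_mult[OF left_ideal_jacobson_radical])

lemma (in fd_algebra) scale_eq_mult: "scale c x = scale c 1 * x"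
  using scale_mult_left[of c 1 x] by simp

lemma (in fd_algebra) left_ideal_scale: "left_ideal I \<Longrightarrow> x \<in> I \<Longrightarrow> scale c x \<in> I"
  by (subst scale_eq_mult) (rule left_ideal_mult)

text \<open>The scalar \<open>c\<close> is the residue of \<open>x a x\<close> under \<open>x \<Lambda> x / x J x \<cong> k\<close>, an injective map
  that sends the class of \<open>c x\<close> to \<open>c\<close> as well.\<close>

lemma (in fd_algebra) split_idempotent_decompose:
  assumes split: "split_idempotent scale x" and x: "x * x = x"
  obtains c s where "x * a * x = scale c x + s" "s \<in> jacobson_radical"
proof -
  define I where "I = peirce x jacobson_radical x"
  define C where "C = peirce x UNIV x"
  obtain \<phi> where bij: "bij_betw \<phi> {a +o I | a. a \<in> C} UNIV"
    and sc: "\<And>c a. a \<in> C \<Longrightarrow> \<phi> (scale c a +o I) = c * \<phi> (a +o I)"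
    and one: "\<phi> (x +o I) = 1"
    using split unfolding split_idempotent_def Let_def I_def C_def by blast
  define c where "c = \<phi> (x * a * x +o I)"
  have xC: "x \<in> C" unfolding C_def peirce_def using x by (force intro: exI[of _ x])
  have "scale c x \<in> C"
    unfolding C_def peirce_def using x
    by (auto intro!: exI[of _ "scale c x"] simp: scale_mult_left[symmetric] scale_mult_right[symmetric])
  moreover have "x * a * x \<in> C" unfolding C_def peirce_def by blast
  moreover have "\<phi> (x * a * x +o I) = \<phi> (scale c x +o I)"
    using sc[OF xC] one by (simp add: c_def)
  ultimately have "x * a * x +o I = scale c x +o I"
    using bij unfolding bij_betw_def inj_on_def by blast
  moreover have "x * 0 * x \<in> I"
    unfolding I_def peirce_def using left_ideal_zero[OF left_ideal_jacobson_radical] by blast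
  then have "x * a * x \<in> x * a * x +o I" by (auto simp: elt_set_plus_def)
  ultimately obtain s where "s \<in> I" "x * a * x = scale c x + s"
    by (auto simp: elt_set_plus_def)
  then show thesis using that in_peirce_radical unfolding I_def by blast
qed

text \<open>Otherwise \<open>x = f + (x - f)\<close> would be a decomposition into nonzero orthogonal idempotents.\<close>

lemma primitive_idempotent_unique:
  assumes "primitive_idempotent x" "f * f = f" "x * f = f" "f * x = f" "f \<noteq> 0"
  shows "f = x"
proof (rule ccontr)
  assume "f \<noteq> x"
  moreover have "x * x = x" using assms(1) by (simp add: primitive_idempotent_def)
  ultimately have "(x - f) * (x - f) = x - f" "f * (x - f) = 0" "(x - f) * f = 0"
      "x - f \<noteq> 0" "x = f + (x - f)"
    using assms by (simp_all add: algebra_simps)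
  then show False
    using assms unfolding primitive_idempotent_def by blast
qed

lemma left_principal_iff: "x * x = x \<Longrightarrow> a \<in> left_principal x \<longleftrightarrow> a * x = a"
  unfolding left_principal_def by (auto simp: mult.assoc) metis

text \<open>Right multiplications by \<open>a\<close> and \<open>b\<close> are mutually inverse.\<close>

lemma left_principal_isomorphic:
  assumes x: "x * x = x" and y: "y * y = y"
    and a: "x * a = a" "a * y = a" and b: "b * x = b"
    and ab: "a * b = x" "b * a = y"
  shows "module_isomorphic (left_ideal_module (left_principal x)) (left_ideal_module (left_principal y))"
proof -
  have "bij_betw (\<lambda>r. r * a) (left_principal x) (left_principal y)"
    by (rule bij_betw_byWitness[where f' = "\<lambda>r. r * b"])
      (auto simp: left_principal_iff x y a b ab mult.assoc)
  then show ?thesis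
    unfolding module_isomorphic_def left_ideal_module_def
    by (intro exI[of _ "\<lambda>r. r * a"]) (auto simp: distrib_right mult.assoc)
qed

text \<open>Right multiplication by \<open>x r y\<close> is a map \<open>\<Lambda> x \<rightarrow> \<Lambda> y\<close>.  If it lies outside the radical, so does
  its composite with some map \<open>\<Lambda> y \<rightarrow> \<Lambda> x\<close>; as \<open>y \<Lambda> y\<close> consists of scalars modulo a nilpotent ideal,
  that endomorphism of \<open>\<Lambda> y\<close> is invertible.  So \<open>\<Lambda> y\<close> is isomorphic to a nonzero direct summand of
  \<open>\<Lambda> x\<close>, which is \<open>\<Lambda> x\<close> itself because \<open>x\<close> is primitive.\<close>

lemma (in fd_algebra) peirce_subset_radical:
  assumes x: "primitive_idempotent x" and y: "y * y = y" "y \<noteq> 0"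
    and split: "split_idempotent scale y"
    and nilpotent: "ideal_pow (jacobson_radical :: 'a set) n = {0}"
    and niso: "\<not> module_isomorphic (left_ideal_module (left_principal x))
                                     (left_ideal_module (left_principal y))"
  shows "x * r * y \<in> jacobson_radical"
proof (rule ccontr)
  note J = left_ideal_jacobson_radical
  have xx: "x * x = x" using x by (simp add: primitive_idempotent_def)
  define a where "a = x * r * y"
  assume "x * r * y \<notin> jacobson_radical"
  then obtain I where I: "maximal_left_ideal I" "a \<notin> I"
    unfolding a_def jacobson_radical_def by blast
  have xa: "x * a = a" and ay: "a * y = a"
    unfolding a_def using xx y(1) by (simp_all add: mult.assoc) (simp add: mult.assoc[symmetric])
  have "\<exists>z. y * z * a \<notin> jacobson_radical"
  proof (rule ccontr)
    assume all: "\<nexists>z. y * z * a \<notin> jacobson_radical"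
    \<comment> \<open>Then \<open>a z a = a (y z a) \<in> J \<subseteq> I\<close> for all \<open>z\<close>, so \<open>a u \<in> I\<close> for all \<open>u \<in> \<Lambda> a + I = \<Lambda>\<close>.\<close>
    have "left_ideal (UNIV :: 'a set)" by (simp add: left_ideal_def)
    then obtain z where z: "1 - z * a \<in> I"
      using maximal_left_ideal_right_mult_onto[OF I(1), of UNIV 1 a 1] I(2) by auto
    have "a = a * (z * a) + a * (1 - z * a)" by (simp add: right_diff_distrib)
    also have "a * (z * a) = a * (y * z * a)" using ay by (metis mult.assoc)
    finally have "a = a * (y * z * a) + a * (1 - z * a)" .
    moreover have "left_ideal I" using I(1) by (simp add: maximal_left_ideal_def)
    moreover have "y * z * a \<in> I" using all jacobson_radical_subset[OF I(1)] by blast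
    ultimately show False using z I(2) by (metis left_ideal_add left_ideal_mult)
  qed
  then obtain z where z: "y * z * a \<notin> jacobson_radical" by blast
  have "y * (z * a) * y = y * z * a" using ay by (simp add: mult.assoc)
  then obtain c s where cs: "y * z * a = scale c y + s" "s \<in> jacobson_radical"
    using split_idempotent_decompose[OF split y(1), of "z * a"] by metis
  then have c: "c \<noteq> 0" using z by auto
  define s' where "s' = scale (inverse c) s"
  have "s' \<in> jacobson_radical" unfolding s'_def by (rule left_ideal_scale[OF J cs(2)])
  then obtain u where u: "u * (1 + s') = 1"
    using one_plus_left_invertible[OF J nilpotent] by blast
  \<comment> \<open>As \<open>y z a = c (1 + s') y\<close> and \<open>u (1 + s') = 1\<close>, this choice gives \<open>b a = y\<close>.\<close>
  define b where "b = y * scale (inverse c) (u * (y * z * x))"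
  have sy: "s * y = s"
  proof -
    have "s = y * z * a - scale c y" using cs(1) by simp
    then show ?thesis using ay y(1)
      by (simp add: left_diff_distrib mult.assoc scale_mult_left[symmetric])
  qed
  have "b * a = y * (u * scale (inverse c) (y * z * a))"
    unfolding b_def using xa by (simp add: mult.assoc scale_mult_left[symmetric] scale_mult_right[symmetric])
  also have "scale (inverse c) (y * z * a) = (1 + s') * y"
    using c sy unfolding cs(1) s'_def
    by (simp add: scale_right_distrib distrib_right scale_mult_left[symmetric])
  also have "y * (u * ((1 + s') * y)) = y"
    using u y(1) by (simp add: mult.assoc[symmetric])
  finally have ba: "b * a = y" .
  have bx: "b * x = b"
    unfolding b_def using xx by (simp add: mult.assoc scale_mult_left[symmetric])
  have "a * b = x"
  proof (rule primitive_idempotent_unique[OF x])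
    show "a * b * (a * b) = a * b" using ay ba by (metis mult.assoc)
    show "x * (a * b) = a * b" using xa by (simp add: mult.assoc[symmetric])
    show "a * b * x = a * b" using bx by (simp add: mult.assoc)
    show "a * b \<noteq> 0" using y ba by (metis mult.assoc mult_zero_left mult_zero_right)
  qed
  then show False
    using left_principal_isomorphic[OF xx y(1) xa ay bx _ ba] niso by blast
qed

section \<open>Quotients of left ideals\<close>

lemma coset_eq_iff: "left_ideal K \<Longrightarrow> x +o K = y +o K \<longleftrightarrow> x - y \<in> K"
proof
  assume K: "left_ideal K"
  show "x - y \<in> K" if "x +o K = y +o K"
  proof -
    have "x \<in> x +o K" using left_ideal_zero[OF K] by (auto simp: elt_set_plus_def)
    then have "x \<in> y +o K" using that by simp
    then show ?thesis by (auto simp: elt_set_plus_def)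
  qed
  have sub: "x +o K \<subseteq> y +o K" if "x - y \<in> K" for x y
  proof
    fix z assume "z \<in> x +o K"
    then obtain k where "k \<in> K" "z = x + k" by (auto simp: elt_set_plus_def)
    then have "z = y + (x - y + k)" "x - y + k \<in> K"
      using that left_ideal_add[OF K] by auto
    then show "z \<in> y +o K" unfolding elt_set_plus_def by blast
  qed
  show "x +o K = y +o K" if "x - y \<in> K"
    using sub[OF that] sub[of y x] left_ideal_uminus[OF K that] by simp
qed

lemma coset_add: "left_ideal K \<Longrightarrow> (x +o K) + (y +o K) = (x + y) +o K"
proof -
  assume K: "left_ideal K"
  have "K + K = K"
    using left_ideal_add[OF K] left_ideal_zero[OF K]
    by (auto simp: set_plus_def) (metis add.right_neutral)
  then show ?thesis by (simp add: set_plus_rearrange)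
qed

lemma coset_act:
  assumes K: "left_ideal K"
  shows "r *o (x +o K) + K = r * x +o K"
proof (intro set_eqI iffI)
  fix z assume "z \<in> r *o (x +o K) + K"
  then obtain k l where "k \<in> K" "l \<in> K" "z = r * (x + k) + l"
    by (auto simp: set_plus_def elt_set_plus_def elt_set_times_def)
  then have "z = r * x + (r * k + l)" "r * k + l \<in> K"
    using K by (auto simp: distrib_left add.assoc left_ideal_add left_ideal_mult)
  then show "z \<in> r * x +o K" unfolding elt_set_plus_def by blast
next
  fix z assume "z \<in> r * x +o K"
  then obtain k where "k \<in> K" "z = r * (x + 0) + k" by (auto simp: elt_set_plus_def)
  then show "z \<in> r *o (x +o K) + K"
    using left_ideal_zero[OF K] unfolding set_plus_def elt_set_plus_def elt_set_times_def by blast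
qed

lemma left_module_quotient_module:
  assumes P: "left_ideal P" and K: "left_ideal K"
  shows "left_module (quotient_module P K)"
proof -
  have mem: "x \<in> P \<Longrightarrow> x +o K \<in> {x +o K |x. x \<in> P}" for x by blast
  have zero: "K = 0 +o K" by simp
  have C: "(\<forall>A\<in>{x +o K |x. x \<in> P}. Q A) \<longleftrightarrow> (\<forall>x\<in>P. Q (x +o K))" for Q by blast
  show ?thesis
    unfolding left_module_def quotient_module_def lmod.simps C
  proof (intro conjI ballI allI)
    show "K \<in> {x +o K |x. x \<in> P}" using mem[OF left_ideal_zero[OF P]] by simp
    show "K + (x +o K) = x +o K" for x
      using coset_add[OF K, of 0 x] by simp
    show "\<exists>y\<in>{x +o K |x. x \<in> P}. y + (x +o K) = K" if "x \<in> P" for x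
      using mem[OF left_ideal_uminus[OF P that]] coset_add[OF K, of "- x" x] by force
    show "x +o K + (y +o K) + (z +o K) = x +o K + (y +o K + (z +o K))" for x y z
      by (rule add.assoc)
    show "x +o K + (y +o K) = y +o K + (x +o K)" for x y
      by (rule add.commute)
  qed (simp_all only: coset_add[OF K] coset_act[OF K] mem left_ideal_add[OF P]
      left_ideal_mult[OF P] distrib_left distrib_right mult.assoc mult_1)
qed

text \<open>A homomorphism is determined by the image of the generator \<open>x + K\<close>, which can be represented
  in \<open>x \<Lambda> x\<close>; it therefore lifts to a right multiplication, and injectivity says which elements
  land in \<open>L\<close>.\<close>

lemma quotient_module_isomorphism_right_mult:
  assumes x: "x * x = x" and K: "left_ideal K" and L: "left_ideal L"
    and iso: "module_isomorphic (quotient_module (left_principal x) K)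
                                (quotient_module (left_principal x) L)"
  obtains y where "x * y * x = y"
    "\<And>a. a \<in> left_principal x \<Longrightarrow> a \<in> K \<longleftrightarrow> a * y \<in> L"
proof -
  obtain f where bij: "bij_betw f {a +o K |a. a \<in> left_principal x} {a +o L |a. a \<in> left_principal x}"
    and act: "\<And>r a. a \<in> left_principal x \<Longrightarrow> f (r *o (a +o K) + K) = r *o f (a +o K) + L"
    using iso unfolding module_isomorphic_def quotient_module_def lmod.simps
    by (elim exE conjE) (rule that, assumption, blast)
  have xP: "x \<in> left_principal x" using x by (simp add: left_principal_iff)
  then obtain z where z: "z \<in> left_principal x" "f (x +o K) = z +o L"
    using bij unfolding bij_betw_def by blast
  have f: "f (a +o K) = a * (x * z) +o L" if "a \<in> left_principal x" for a
  proof -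
    have ax: "a * x = a" using that x by (simp add: left_principal_iff)
    have "f (a +o K) = f (a *o (x +o K) + K)" by (simp add: coset_act[OF K] ax)
    also have "\<dots> = a * z +o L" by (simp add: act[OF xP] z(2) coset_act[OF L])
    finally show ?thesis using ax by (simp add: mult.assoc[symmetric])
  qed
  have zero: "0 \<in> left_principal x" by (rule left_ideal_zero[OF left_ideal_left_principal])
  show thesis
  proof
    show "x * (x * z) * x = x * z"
      using z(1) x by (simp add: left_principal_iff mult.assoc) (simp add: mult.assoc[symmetric])
    show "a \<in> K \<longleftrightarrow> a * (x * z) \<in> L" if a: "a \<in> left_principal x" for a
    proof -
      have "a \<in> K \<longleftrightarrow> a +o K = 0 +o K" by (simp only: coset_eq_iff[OF K] diff_zero)
      also have "\<dots> \<longleftrightarrow> f (a +o K) = f (0 +o K)"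
        by (rule inj_on_eq_iff[symmetric, OF bij_betw_imp_inj_on[OF bij]]) (use a zero in blast)+
      also have "\<dots> \<longleftrightarrow> a * (x * z) \<in> L"
        by (simp only: f[OF a] f[OF zero] coset_eq_iff[OF L] mult_zero_left diff_zero)
      finally show ?thesis .
    qed
  qed
qed

section \<open>Projective spaces of functionals\<close>

lemma fun_span_singleton_eq:
  assumes "g \<in> fun_space.span {f}" "g \<noteq> 0"
  shows "fun_space.span {g} = fun_space.span {f}"
proof -
  obtain c where g: "g = fun_scale c f"
    using assms(1) by (auto simp: fun_space.span_singleton)
  then have "c \<noteq> 0" using assms(2) by auto
  then have "f = fun_scale (inverse c) g" by (simp add: g)
  then have "f \<in> fun_space.span {g}" by (auto simp: fun_space.span_singleton)
  then show ?thesis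
    using assms(1) by (intro subset_antisym fun_space.span_minimal) auto
qed

lemma proj_space_eq:
  assumes X: "fun_space.subspace X"
  shows "proj_space X = {fun_space.span {f} | f. f \<in> X \<and> f \<noteq> 0}"
proof (intro set_eqI iffI)
  fix L assume "L \<in> proj_space X"
  then have L: "L \<subseteq> X" "fun_space.subspace L" "fun_space.dim L = 1"
    by (auto simp: proj_space_def)
  obtain B where B: "B \<subseteq> L" "fun_space.independent B" "L \<subseteq> fun_space.span B"
      "card B = fun_space.dim L"
    using fun_space.basis_exists by blast
  then obtain f where f: "B = {f}" using L(3) by (metis card_1_singletonE)
  then have "f \<noteq> 0" using B(2) by (metis fun_space.dependent_zero insertI1)
  moreover have "L = fun_space.span {f}"
    using B L(2) f by (metis fun_space.span_subspace)
  ultimately show "L \<in> {fun_space.span {f} | f. f \<in> X \<and> f \<noteq> 0}"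
    using B(1) L(1) f by blast
next
  fix L assume "L \<in> {fun_space.span {f} | f. f \<in> X \<and> f \<noteq> 0}"
  then obtain f where f: "L = fun_space.span {f}" "f \<in> X" "f \<noteq> 0" by blast
  then have "fun_space.dim L = 1"
    using fun_space.dim_eq_card_independent[of "{f}"] by (simp add: fun_space.dependent_single)
  then show "L \<in> proj_space X"
    using f X by (auto simp: proj_space_def fun_space.span_minimal subsetD[OF fun_space.span_minimal])
qed

text \<open>A line consists of the multiples of one vector, so a homogeneous bijection carries lines to
  lines.\<close>

lemma proj_space_bij_betw:
  assumes X: "fun_space.subspace X" and Y: "fun_space.subspace Y"
    and T: "bij_betw T X Y"
    and hom: "\<And>c f. f \<in> X \<Longrightarrow> T (fun_scale c f) = fun_scale c (T f)"
  shows "bij_betw (\<lambda>L. T ` L) (proj_space X) (proj_space Y)"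
proof -
  have zX: "0 \<in> X" using X by (simp add: fun_space.subspace_0)
  have zero: "T 0 = 0" using hom[OF zX, of 0] by simp
  have nz: "T f = 0 \<longleftrightarrow> f = 0" if "f \<in> X" for f
    using T zX zero that unfolding bij_betw_def inj_on_def by metis
  have img: "T ` fun_space.span {f} = fun_space.span {T f}" if "f \<in> X" for f
    using hom[OF that] by (auto simp: fun_space.span_singleton image_image)
  have "inj_on (\<lambda>L. T ` L) (Pow X)"
    using T inj_on_image_Pow by (auto simp: bij_betw_def)
  moreover have "proj_space X \<subseteq> Pow X" by (auto simp: proj_space_def)
  moreover have "(\<lambda>L. T ` L) ` proj_space X = proj_space Y"
  proof (intro set_eqI iffI)
    fix M assume "M \<in> (\<lambda>L. T ` L) ` proj_space X"
    then obtain f where "f \<in> X" "f \<noteq> 0" "M = T ` fun_space.span {f}"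
      unfolding proj_space_eq[OF X] by blast
    then show "M \<in> proj_space Y"
      using T nz img unfolding proj_space_eq[OF Y] bij_betw_def by blast
  next
    fix M assume "M \<in> proj_space Y"
    then obtain g where g: "g \<in> Y" "g \<noteq> 0" "M = fun_space.span {g}"
      unfolding proj_space_eq[OF Y] by blast
    then obtain f where "f \<in> X" "g = T f" using T unfolding bij_betw_def by blast
    then show "M \<in> (\<lambda>L. T ` L) ` proj_space X"
      using g nz img unfolding proj_space_eq[OF X] by blast
  qed
  ultimately show ?thesis unfolding bij_betw_def by (meson inj_on_subset)
qed

lemma subspace_dual_space: "fun_space.subspace (dual_space scale V)"
  by (auto simp: fun_space.subspace_def dual_space_def fun_scale_def algebra_simps)

lemma subspace_coord_space: "fun_space.subspace (coord_space m)"
  by (auto simp: fun_space.subspace_def coord_space_def fun_scale_def)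

lemma dual_space_add: "\<phi> \<in> dual_space scale V \<Longrightarrow> x \<in> V \<Longrightarrow> y \<in> V \<Longrightarrow> \<phi> (x + y) = \<phi> x + \<phi> y"
  and dual_space_scale: "\<phi> \<in> dual_space scale V \<Longrightarrow> x \<in> V \<Longrightarrow> \<phi> (scale c x) = c * \<phi> x"
  and dual_space_outside: "\<phi> \<in> dual_space scale V \<Longrightarrow> x \<notin> V \<Longrightarrow> \<phi> x = 0"
  by (simp_all add: dual_space_def)

lemma (in vector_space) dual_space_zero:
  "subspace V \<Longrightarrow> \<phi> \<in> dual_space scale V \<Longrightarrow> \<phi> 0 = 0"
  using dual_space_scale[of \<phi> scale V 0 0] subspace_0[of V] by simp

text \<open>Choose \<open>v\<close> with \<open>\<phi> v \<noteq> 0\<close>.  Every \<open>x \<in> V\<close> differs from a multiple of \<open>v\<close> by an element of the kernel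
  of \<open>\<phi>\<close>, so \<open>\<psi>\<close> is determined by its value at \<open>v\<close>.\<close>

lemma (in vector_space) dual_space_span_of_kernel:
  assumes V: "subspace V" and \<phi>: "\<phi> \<in> dual_space scale V" and \<psi>: "\<psi> \<in> dual_space scale V"
    and nz: "\<phi> \<noteq> 0" and ker: "\<And>v. v \<in> V \<Longrightarrow> \<phi> v = 0 \<Longrightarrow> \<psi> v = 0"
  shows "\<psi> \<in> fun_space.span {\<phi>}"
proof -
  obtain v where v: "\<phi> v \<noteq> 0" using nz by (auto simp: fun_eq_iff)
  then have vV: "v \<in> V" using dual_space_outside[OF \<phi>] by blast
  have "\<psi> x = \<psi> v / \<phi> v * \<phi> x" for x
  proof (cases "x \<in> V")
    case True
    define w where "w = x + scale (- (\<phi> x / \<phi> v)) v"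
    have s: "scale (- (\<phi> x / \<phi> v)) v \<in> V" using V vV by (rule subspace_scale)
    have w: "w \<in> V" unfolding w_def using V True s by (rule subspace_add)
    have val: "\<chi> w = \<chi> x - \<phi> x / \<phi> v * \<chi> v" if "\<chi> \<in> dual_space scale V" for \<chi>
    proof -
      have "\<chi> w = \<chi> x + \<chi> (scale (- (\<phi> x / \<phi> v)) v)"
        unfolding w_def by (rule dual_space_add[OF that True s])
      also have "\<chi> (scale (- (\<phi> x / \<phi> v)) v) = - (\<phi> x / \<phi> v) * \<chi> v"
        by (rule dual_space_scale[OF that vV])
      finally show ?thesis by simp
    qed
    have "\<phi> w = 0" using val[OF \<phi>] v by simp
    then have "\<psi> w = 0" using ker[OF w] by simp
    then show ?thesis using val[OF \<psi>] by simp
  next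
    case False
    then show ?thesis by (simp add: dual_space_outside[OF \<phi>] dual_space_outside[OF \<psi>])
  qed
  then have "\<psi> = fun_scale (\<psi> v / \<phi> v) \<phi>"
    unfolding fun_scale_def by (rule ext)
  then show ?thesis by (simp add: fun_space.span_singleton)
qed

lemma (in vector_space) dual_coords_bij_betw:
  assumes b: "is_basis scale V m b"
  shows "bij_betw (dual_coords m b) (dual_space scale V) (coord_space m)"
proof -
  define B where "B = b ` {..<m}"
  have inj: "inj_on b {..<m}" and ind: "independent B" and V: "span B = V"
    using b by (auto simp: is_basis_def B_def)
  have bV: "b l \<in> V" if "l < m" for l
    using that V span_superset[of B] by (auto simp: B_def)
  have sub: "subspace V" using V by auto
  have "inj_on (dual_coords m b) (dual_space scale V)"
  proof (rule inj_onI)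
    fix \<phi> \<psi> assume \<phi>: "\<phi> \<in> dual_space scale V" and \<psi>: "\<psi> \<in> dual_space scale V"
      and eq: "dual_coords m b \<phi> = dual_coords m b \<psi>"
    have B: "\<phi> x = \<psi> x" if x: "x \<in> B" for x
    proof -
      obtain l where "l < m" "x = b l" using x by (auto simp: B_def)
      then show ?thesis using fun_cong[OF eq, of l] by (simp add: dual_coords_def)
    qed
    have "x \<in> V \<and> \<phi> x = \<psi> x" if "x \<in> span B" for x
      using that
    proof (induction rule: span_induct_alt)
      case base
      then show ?case by (simp add: subspace_0[OF sub] dual_space_zero[OF sub \<phi>] dual_space_zero[OF sub \<psi>])
    next
      case (step c x y)
      have x: "x \<in> V" using span_base[OF step.hyps(1)] by (simp only: V)
      have y: "y \<in> V" and eq: "\<phi> y = \<psi> y" using step.IH by simp_all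
      have cx: "scale c x \<in> V" by (rule subspace_scale[OF sub x])
      show ?case
        by (simp add: subspace_add[OF sub cx y] dual_space_add[OF \<phi> cx y] dual_space_add[OF \<psi> cx y]
            dual_space_scale[OF \<phi> x] dual_space_scale[OF \<psi> x] B[OF step.hyps(1)] eq)
    qed
    then have "\<phi> x = \<psi> x" for x
      unfolding V using dual_space_outside[OF \<phi>, of x] dual_space_outside[OF \<psi>, of x] by metis
    then show "\<phi> = \<psi>" by (rule ext)
  qed
  moreover have "dual_coords m b ` dual_space scale V = coord_space m"
  proof (intro set_eqI iffI)
    fix v :: "nat \<Rightarrow> 'a" assume v: "v \<in> coord_space m"
    \<comment> \<open>The functional with value \<open>v l\<close> at \<open>b l\<close>, extended by \<open>0\<close> outside \<open>V\<close>.\<close>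
    define \<phi> where "\<phi> x = (if x \<in> V then \<Sum>l<m. v l * representation B x (b l) else 0)" for x
    have "\<phi> (x + y) = \<phi> x + \<phi> y" if "x \<in> V" "y \<in> V" for x y
    proof -
      have "representation B (x + y) = (\<lambda>u. representation B x u + representation B y u)"
        using that V by (intro representation_add[OF ind]) simp_all
      then show ?thesis
        using that subspace_add[OF sub that] by (simp add: \<phi>_def distrib_left sum.distrib)
    qed
    moreover have "\<phi> (scale c x) = c * \<phi> x" if "x \<in> V" for c x
    proof -
      have "representation B (scale c x) = (\<lambda>u. c * representation B x u)"
        using that V by (intro representation_scale[OF ind]) simp_all
      then show ?thesis
        using that subspace_scale[OF sub that]
        by (simp add: \<phi>_def sum_distrib_left mult.left_commute)
    qed
    moreover have "\<phi> x = 0" if "x \<notin> V" for x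
      using that by (simp add: \<phi>_def)
    ultimately have "\<phi> \<in> dual_space scale V" by (simp add: dual_space_def)
    moreover have "dual_coords m b \<phi> = v"
    proof
      fix l
      show "dual_coords m b \<phi> l = v l"
      proof (cases "l < m")
        case True
        have "representation B (b l) (b q) = (if q = l then 1 else 0)" if "q < m" for q
          using True that inj ind by (auto simp: representation_basis B_def inj_on_def)
        then have "(\<Sum>q<m. v q * representation B (b l) (b q)) = (\<Sum>q<m. if q = l then v q else 0)"
          by (intro sum.cong) auto
        then show ?thesis using True bV by (simp add: dual_coords_def \<phi>_def)
      next
        case False
        then show ?thesis using v by (simp add: dual_coords_def coord_space_def)
      qed
    qed
    ultimately show "v \<in> dual_coords m b ` dual_space scale V" by blast
  qed (auto simp: dual_coords_def coord_space_def)
  ultimately show ?thesis by (simp add: bij_betw_def)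
qed

lemma (in fd_algebra) is_basis_exists:
  assumes V: "subspace V"
  shows "\<exists>b. is_basis scale V (dim V) b"
proof -
  obtain B where B: "B \<subseteq> V" "independent B" "V \<subseteq> span B" "card B = dim V"
    using basis_exists by blast
  obtain S where S: "finite S" "span S = UNIV" using finite_dim by blast
  have "finite B" using independent_span_bound[OF S(1) B(2)] S(2) by simp
  then obtain b where "bij_betw b {..<card B} B"
    using ex_bij_betw_nat_finite by (metis atLeast0LessThan)
  moreover have "span B = V" using B V span_subspace by blast
  ultimately have "is_basis scale V (dim V) b"
    using B(2,4) by (auto simp: is_basis_def bij_betw_def)
  then show ?thesis by blast
qed

section \<open>The modules of the fibre\<close>

locale split_basic_nilpotent_algebra = fd_algebra scale
  for scale :: "'k::field \<Rightarrow> 'a::ring_1 \<Rightarrow> 'a" +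
  fixes e :: "nat \<Rightarrow> 'a" and t n i j :: nat
  assumes complete: "complete_primitive_orthogonal e t"
    and basic: "basic_algebra e t"
    and split: "split_algebra scale e t"
    and n_pos: "n \<ge> 1"
    and nilpotent: "ideal_pow (jacobson_radical :: 'a set) n = {0}"
    and i: "i \<in> {1..t}" and j: "j \<in> {1..t}"
begin

definition last_power :: "'a set" where
  "last_power = ideal_pow jacobson_radical (n - 1)"

abbreviation "V \<equiv> V_space e n i j"
abbreviation "T \<equiv> top_layer e n i"
abbreviation "K \<equiv> K_submodule e t n i j"
abbreviation "M \<equiv> M_module e t n i j"

lemma primitive: "h \<in> {1..t} \<Longrightarrow> primitive_idempotent (e h)"
  and orthogonal: "h \<in> {1..t} \<Longrightarrow> l \<in> {1..t} \<Longrightarrow> h \<noteq> l \<Longrightarrow> e h * e l = 0"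
  and sum_e: "(\<Sum>h\<in>{1..t}. e h) = 1"
  using complete unfolding complete_primitive_orthogonal_def by blast+

lemma idem: "h \<in> {1..t} \<Longrightarrow> e h * e h = e h"
  and e_nonzero: "h \<in> {1..t} \<Longrightarrow> e h \<noteq> 0"
  using primitive unfolding primitive_idempotent_def by blast+

lemma split_e: "h \<in> {1..t} \<Longrightarrow> split_idempotent scale (e h)"
  using split by (simp add: split_algebra_def)

lemma left_ideal_last_power: "left_ideal last_power"
  unfolding last_power_def by (rule left_ideal_ideal_pow[OF left_ideal_jacobson_radical])

lemma last_power_mult_right: "x \<in> last_power \<Longrightarrow> x * r \<in> last_power"
  unfolding last_power_def by (rule ideal_pow_mult_right)

lemma radical_mult_last_power: "s \<in> jacobson_radical \<Longrightarrow> x \<in> last_power \<Longrightarrow> s * x = 0"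
  using ideal_prod_mult[of s jacobson_radical x last_power] nilpotent n_pos
  unfolding last_power_def by (cases n) auto

lemma last_power_mult_radical: "x \<in> last_power \<Longrightarrow> s \<in> jacobson_radical \<Longrightarrow> x * s = 0"
  using ideal_pow_Suc_right[OF left_ideal_jacobson_radical, of s x "n - 1"] nilpotent n_pos
  unfolding last_power_def by (simp del: ideal_pow.simps)

lemma off_diagonal_in_radical:
  assumes "h \<in> {1..t}" "l \<in> {1..t}" "h \<noteq> l"
  shows "e h * r * e l \<in> jacobson_radical"
  using assms basic
  by (intro peirce_subset_radical[OF primitive _ _ split_e nilpotent] idem e_nonzero)
    (auto simp: basic_algebra_def)

lemma top_layer_iff: "x \<in> T \<longleftrightarrow> x \<in> last_power \<and> x * e i = x"
proof
  assume "x \<in> T"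
  then have "x \<in> ideal_prod last_power (left_principal (e i))"
    by (simp add: top_layer_def last_power_def)
  then show "x \<in> last_power \<and> x * e i = x"
  proof (induction rule: ideal_prod_induct)
    case zero
    then show ?case by (simp add: left_ideal_zero[OF left_ideal_last_power])
  next
    case (add x y)
    then show ?case by (simp add: left_ideal_add[OF left_ideal_last_power] distrib_right)
  next
    case (mult a b)
    then show ?case
      by (simp add: last_power_mult_right left_principal_iff[OF idem[OF i]] mult.assoc)
  qed
next
  assume x: "x \<in> last_power \<and> x * e i = x"
  then have "x * e i \<in> ideal_prod last_power (left_principal (e i))"
    by (intro ideal_prod_mult) (simp_all add: left_principal_iff[OF idem[OF i]] idem[OF i])
  then show "x \<in> T" using x by (simp add: top_layer_def last_power_def)
qed

lemma left_ideal_top_layer: "left_ideal T"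
  unfolding top_layer_def
  by (intro left_ideal_ideal_prod left_ideal_ideal_pow left_ideal_jacobson_radical)

lemma V_space_iff: "v \<in> V \<longleftrightarrow> v \<in> T \<and> e j * v = v"
proof
  assume "v \<in> V"
  then obtain a where a: "a \<in> last_power" "v = e j * a * e i"
    unfolding V_space_def peirce_def last_power_def by blast
  have "v \<in> last_power"
    unfolding a(2) by (intro last_power_mult_right left_ideal_mult[OF left_ideal_last_power] a(1))
  moreover have "v * e i = v" by (simp add: a(2) mult.assoc idem[OF i])
  moreover have "e j * v = v" by (simp add: a(2) mult.assoc[symmetric] idem[OF j])
  ultimately show "v \<in> T \<and> e j * v = v" by (simp add: top_layer_iff)
next
  assume "v \<in> T \<and> e j * v = v"
  then have "v \<in> last_power" "v = e j * v * e i" by (simp_all add: top_layer_iff)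
  then show "v \<in> V" unfolding V_space_def peirce_def last_power_def by blast
qed

lemma e_mult_top_layer: "x \<in> T \<Longrightarrow> e j * x \<in> V"
  by (simp add: V_space_iff left_ideal_mult[OF left_ideal_top_layer] mult.assoc[symmetric] idem[OF j])

lemma subspace_V_space: "subspace V"
  unfolding subspace_def Ball_def V_space_iff
  by (simp add: left_ideal_zero[OF left_ideal_top_layer] left_ideal_add[OF left_ideal_top_layer]
      left_ideal_scale[OF left_ideal_top_layer] distrib_left scale_mult_right[symmetric])

text \<open>Since \<open>x = e\<^sub>j x + \<Sum>\<^sub>h e\<^sub>h x\<close> over \<open>h \<noteq> j\<close>, the summand \<open>W\<close> imposes no condition on \<open>e\<^sub>j x\<close> and
  the kernel is the only one.  In this form closure under multiplication can be tested on
  \<open>e\<^sub>j\<close>-components.\<close>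

lemma K_submodule_iff:
  assumes \<phi>: "\<phi> \<in> dual_space scale V"
  shows "x \<in> K \<phi> \<longleftrightarrow> x \<in> T \<and> \<phi> (e j * x) = 0"
proof
  assume "x \<in> K \<phi>"
  then obtain w v where w: "w \<in> W_space e t n i j" and v: "v \<in> V" "\<phi> v = 0" and x: "x = w + v"
    unfolding K_submodule_def set_plus_def by blast
  obtain f where f: "w = (\<Sum>h\<in>{1..t} - {j}. f h)" "\<forall>h\<in>{1..t} - {j}. f h \<in> e h *o T"
    using w unfolding W_space_def by blast
  have fh: "f h \<in> T \<and> e j * f h = 0" if h: "h \<in> {1..t} - {j}" for h
  proof -
    obtain y where y: "y \<in> T" "f h = e h * y" using f(2) h unfolding elt_set_times_def by blast
    have "e j * f h = (e j * e h) * y" by (simp add: y(2) mult.assoc)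
    also have "\<dots> = 0" using h orthogonal[OF j, of h] by auto
    finally show ?thesis using left_ideal_mult[OF left_ideal_top_layer y(1)] y(2) by simp
  qed
  have "w \<in> T" unfolding f(1) using fh by (intro left_ideal_sum[OF left_ideal_top_layer]) simp
  moreover have "e j * w = 0" unfolding f(1) sum_distrib_left using fh by (intro sum.neutral) simp
  ultimately show "x \<in> T \<and> \<phi> (e j * x) = 0"
    using v by (simp add: x V_space_iff left_ideal_add[OF left_ideal_top_layer] distrib_left)
next
  assume x: "x \<in> T \<and> \<phi> (e j * x) = 0"
  have "x = (\<Sum>h\<in>{1..t}. e h) * x" by (simp only: sum_e mult_1_left)
  also have "\<dots> = e j * x + (\<Sum>h\<in>{1..t} - {j}. e h * x)"
    unfolding sum_distrib_right using j by (intro sum.remove) simp_all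
  finally have "x = (\<Sum>h\<in>{1..t} - {j}. e h * x) + e j * x" by (simp add: add.commute)
  moreover have "(\<Sum>h\<in>{1..t} - {j}. e h * x) \<in> W_space e t n i j"
    unfolding W_space_def elt_set_times_def using x by blast
  moreover have "e j * x \<in> {v \<in> V. \<phi> v = 0}" using x e_mult_top_layer by simp
  ultimately show "x \<in> K \<phi>" unfolding K_submodule_def by (metis set_plus_intro)
qed

text \<open>Since \<open>J T = 0\<close>, only the class of \<open>e\<^sub>j r\<close> modulo \<open>J\<close> acts on \<open>T\<close>: its part in
  \<open>e\<^sub>j \<Lambda> e\<^sub>h\<close> with \<open>h \<noteq> j\<close> vanishes because \<open>\<Lambda>\<close> is basic, and its part in \<open>e\<^sub>j \<Lambda> e\<^sub>j\<close> is a scalar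
  because \<open>\<Lambda>\<close> is split.\<close>

lemma e_act_top_layer:
  obtains c where "\<And>x. x \<in> T \<Longrightarrow> e j * (r * x) = scale c (e j * x)"
proof -
  obtain c s where cs: "e j * r * e j = scale c (e j) + s" "s \<in> jacobson_radical"
    using split_idempotent_decompose[OF split_e[OF j] idem[OF j]] .
  have "e j * (r * x) = scale c (e j * x)" if x: "x \<in> T" for x
  proof -
    have J: "s * x = 0" if "s \<in> jacobson_radical" for s
      using that x radical_mult_last_power by (simp add: top_layer_iff)
    have "e j * (r * x) = e j * r * (\<Sum>h\<in>{1..t}. e h) * x"
      by (simp only: sum_e mult.assoc mult_1_left)
    also have "\<dots> = (\<Sum>h\<in>{1..t}. e j * r * e h * x)"
      by (simp only: sum_distrib_left sum_distrib_right)
    also have "\<dots> = e j * r * e j * x + (\<Sum>h\<in>{1..t} - {j}. e j * r * e h * x)"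
      using j by (intro sum.remove) simp_all
    also have "(\<Sum>h\<in>{1..t} - {j}. e j * r * e h * x) = 0"
      using j by (intro sum.neutral ballI J off_diagonal_in_radical) auto
    also have "e j * r * e j * x + 0 = scale c (e j * x)"
      by (simp add: cs(1) distrib_right J[OF cs(2)] scale_mult_left)
    finally show ?thesis .
  qed
  then show thesis by (rule that)
qed

lemma left_ideal_K_submodule:
  assumes \<phi>: "\<phi> \<in> dual_space scale V"
  shows "left_ideal (K \<phi>)"
  unfolding left_ideal_def
proof (intro conjI ballI allI)
  note mem = K_submodule_iff[OF \<phi>]
  show "0 \<in> K \<phi>"
    by (simp add: mem left_ideal_zero[OF left_ideal_top_layer] dual_space_zero[OF subspace_V_space \<phi>])
  show "x + y \<in> K \<phi>" if "x \<in> K \<phi>" "y \<in> K \<phi>" for x y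
    using that
    by (simp add: mem left_ideal_add[OF left_ideal_top_layer] distrib_left
        dual_space_add[OF \<phi>] e_mult_top_layer)
  show "r * x \<in> K \<phi>" if x: "x \<in> K \<phi>" for r x
  proof -
    obtain c where "\<And>x. x \<in> T \<Longrightarrow> e j * (r * x) = scale c (e j * x)"
      using e_act_top_layer[of r] by blast
    then show ?thesis
      using x by (simp add: mem left_ideal_mult[OF left_ideal_top_layer] dual_space_scale[OF \<phi>] e_mult_top_layer)
  qed
qed

lemma left_module_M_module: "\<phi> \<in> dual_space scale V \<Longrightarrow> left_module (M \<phi>)"
  unfolding M_module_def
  by (intro left_module_quotient_module left_ideal_left_principal left_ideal_K_submodule)

text \<open>An isomorphism \<open>M \<phi> \<rightarrow> M \<psi>\<close> lifts to right multiplication by some \<open>y = c e\<^sub>i + s\<close> with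
  \<open>s \<in> J\<close>.  As \<open>V J = 0\<close>, it acts on \<open>V\<close> as the scalar \<open>c\<close>, and so compares the two kernels
  inside \<open>V\<close>.  If \<open>c\<close> were \<open>0\<close>, all of \<open>V\<close> would lie in the kernel of \<open>\<phi>\<close>.\<close>

lemma M_module_isomorphic_imp_kernel_eq:
  assumes \<phi>: "\<phi> \<in> dual_space scale V" "\<phi> \<noteq> 0" and \<psi>: "\<psi> \<in> dual_space scale V"
    and iso: "module_isomorphic (M \<phi>) (M \<psi>)" and v: "v \<in> V"
  shows "\<phi> v = 0 \<longleftrightarrow> \<psi> v = 0"
proof -
  obtain y where y: "e i * y * e i = y"
    and mem: "\<And>a. a \<in> left_principal (e i) \<Longrightarrow> a \<in> K \<phi> \<longleftrightarrow> a * y \<in> K \<psi>"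
    using quotient_module_isomorphism_right_mult[OF idem[OF i] left_ideal_K_submodule[OF \<phi>(1)]
        left_ideal_K_submodule[OF \<psi>] iso[unfolded M_module_def]] by blast
  obtain c s where "e i * y * e i = scale c (e i) + s" and s: "s \<in> jacobson_radical"
    using split_idempotent_decompose[OF split_e[OF i] idem[OF i]] .
  then have cs: "y = scale c (e i) + s" by (simp add: y)
  have ker: "\<phi> u = 0 \<longleftrightarrow> c = 0 \<or> \<psi> u = 0" if u: "u \<in> V" for u
  proof -
    have uT: "u \<in> T" "e j * u = u" using u by (simp_all add: V_space_iff)
    then have ul: "u \<in> last_power" "u * e i = u" by (simp_all add: top_layer_iff)
    have uy: "u * y = scale c u"
      by (simp add: cs distrib_left last_power_mult_radical[OF ul(1) s] scale_mult_right[symmetric] ul(2))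
    have "\<phi> u = 0 \<longleftrightarrow> u \<in> K \<phi>" by (simp add: K_submodule_iff[OF \<phi>(1)] uT)
    also have "\<dots> \<longleftrightarrow> scale c u \<in> K \<psi>"
      using mem[of u] ul(2) by (simp add: left_principal_iff[OF idem[OF i]] uy)
    also have "\<dots> \<longleftrightarrow> c * \<psi> u = 0"
      by (simp add: K_submodule_iff[OF \<psi>] left_ideal_scale[OF left_ideal_top_layer uT(1)]
          scale_mult_right[symmetric] uT(2) dual_space_scale[OF \<psi> u])
    finally show ?thesis by simp
  qed
  have "c \<noteq> 0"
  proof
    assume "c = 0"
    then have "\<phi> u = 0" for u
      using ker[of u] dual_space_outside[OF \<phi>(1), of u] by blast
    then have "\<phi> = 0" by (simp add: fun_eq_iff)
    then show False using \<phi>(2) by contradiction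
  qed
  then show ?thesis using ker[OF v] by simp
qed

lemma K_submodule_cong_span:
  assumes "fun_space.span {\<phi>} = fun_space.span {\<psi>}"
  shows "K \<phi> = K \<psi>"
proof -
  have "\<phi> \<in> fun_space.span {\<psi>}" "\<psi> \<in> fun_space.span {\<phi>}"
    using assms fun_space.span_base[of \<phi> "{\<phi>}"] fun_space.span_base[of \<psi> "{\<psi>}"] by simp_all
  then obtain c d where c: "\<phi> = fun_scale c \<psi>" and d: "\<psi> = fun_scale d \<phi>"
    unfolding fun_space.span_singleton by blast
  have "\<phi> v = 0 \<longleftrightarrow> \<psi> v = 0" for v
    using fun_cong[OF c, of v] fun_cong[OF d, of v]
    unfolding fun_scale_def by (metis mult_zero_right)
  then show ?thesis by (simp add: K_submodule_def)
qed

text \<open>Equality of the classes gives an isomorphism because \<open>M \<psi>\<close> belongs to its own class, which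
  needs \<open>M \<psi>\<close> to be a module.\<close>

lemma iso_class_M_module_eq_iff:
  assumes \<phi>: "\<phi> \<in> dual_space scale V" "\<phi> \<noteq> 0" and \<psi>: "\<psi> \<in> dual_space scale V" "\<psi> \<noteq> 0"
  shows "iso_class (M \<phi>) = iso_class (M \<psi>) \<longleftrightarrow> fun_space.span {\<phi>} = fun_space.span {\<psi>}"
proof
  assume eq: "iso_class (M \<phi>) = iso_class (M \<psi>)"
  have "module_isomorphic (M \<psi>) (M \<psi>)"
    unfolding module_isomorphic_def by (rule exI[of _ id]) auto
  then have "M \<psi> \<in> iso_class (M \<psi>)"
    using left_module_M_module[OF \<psi>(1)] by (simp add: iso_class_def)
  then have "module_isomorphic (M \<phi>) (M \<psi>)"
    using eq by (auto simp: iso_class_def)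
  then have "\<psi> \<in> fun_space.span {\<phi>}"
    using M_module_isomorphic_imp_kernel_eq[OF \<phi> \<psi>(1)]
    by (intro dual_space_span_of_kernel[OF subspace_V_space \<phi>(1) \<psi>(1) \<phi>(2)]) blast
  then show "fun_space.span {\<phi>} = fun_space.span {\<psi>}"
    using fun_span_singleton_eq \<psi>(2) by metis
next
  assume "fun_space.span {\<phi>} = fun_space.span {\<psi>}"
  then show "iso_class (M \<phi>) = iso_class (M \<psi>)"
    unfolding M_module_def by (simp only: K_submodule_cong_span[of \<phi> \<psi>])
qed

lemma terminal_fibre_bij_betw:
  obtains \<Phi> where
    "bij_betw \<Phi> (terminal_fibre scale e t n i j) (proj_space (dual_space scale V))"
    "\<And>\<phi>. \<phi> \<in> dual_space scale V \<Longrightarrow> \<phi> \<noteq> 0 \<Longrightarrow> \<Phi> (iso_class (M \<phi>)) = fun_space.span {\<phi>}"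
proof
  define D where "D = {\<phi> \<in> dual_space scale V. \<phi> \<noteq> 0}"
  define C where "C \<phi> = iso_class (M \<phi>)" for \<phi> :: "'a \<Rightarrow> 'k"
  define \<Phi> where "\<Phi> X = fun_space.span {inv_into D C X}" for X
  have fibre: "terminal_fibre scale e t n i j = C ` D"
    unfolding terminal_fibre_def C_def D_def by blast
  have proj: "proj_space (dual_space scale V) = (\<lambda>\<phi>. fun_space.span {\<phi>}) ` D"
    unfolding proj_space_eq[OF subspace_dual_space] D_def by blast
  have eq: "C \<phi> = C \<psi> \<longleftrightarrow> fun_space.span {\<phi>} = fun_space.span {\<psi>}" if "\<phi> \<in> D" "\<psi> \<in> D" for \<phi> \<psi>
    using that iso_class_M_module_eq_iff unfolding C_def D_def by blast
  have \<Phi>: "\<Phi> (C \<phi>) = fun_space.span {\<phi>}" if "\<phi> \<in> D" for \<phi>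
  proof -
    have "C \<phi> \<in> C ` D" using that by (rule imageI)
    then have "inv_into D C (C \<phi>) \<in> D" "C (inv_into D C (C \<phi>)) = C \<phi>"
      by (rule inv_into_into, rule f_inv_into_f)
    then show ?thesis unfolding \<Phi>_def using eq[OF _ that] by blast
  qed
  show "bij_betw \<Phi> (terminal_fibre scale e t n i j) (proj_space (dual_space scale V))"
    unfolding fibre proj bij_betw_def inj_on_def image_image using \<Phi> eq by auto
  show "\<Phi> (iso_class (M \<phi>)) = fun_space.span {\<phi>}"
    if "\<phi> \<in> dual_space scale V" "\<phi> \<noteq> 0" for \<phi>
    using \<Phi>[of \<phi>] that by (simp add: D_def C_def)
qed

end

theorem theorem5p1:
  fixes scale :: "'k::field \<Rightarrow> 'a::ring_1 \<Rightarrow> 'a"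
    and e :: "nat \<Rightarrow> 'a"
    and t n i j m :: nat
  assumes "fd_algebra scale"
    and "complete_primitive_orthogonal e t"
    and "basic_algebra e t"
    and "split_algebra scale e t"
    and "n \<ge> 1"
    and "ideal_pow (jacobson_radical :: 'a set) n = {0}"
    and "i \<in> {1..t}" and "j \<in> {1..t}"
    and "V_space e n i j \<noteq> {0}"
    and "m = vector_space.dim scale (V_space e n i j)"
  shows "\<exists>\<Phi>. bij_betw \<Phi> (terminal_fibre scale e t n i j)
                          (proj_space (dual_space scale (V_space e n i j))) \<and>
             (\<forall>\<phi>\<in>dual_space scale (V_space e n i j). \<phi> \<noteq> 0 \<longrightarrow>
                \<Phi> (iso_class (M_module e t n i j \<phi>)) = fun_space.span {\<phi>}) \<and>
             (\<exists>b. is_basis scale (V_space e n i j) m b) \<and>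
             (\<forall>b. is_basis scale (V_space e n i j) m b \<longrightarrow>
                bij_betw (\<lambda>C. dual_coords m b ` \<Phi> C)
                         (terminal_fibre scale e t n i j)
                         (proj_space (coord_space m :: (nat \<Rightarrow> 'k) set)))"
proof -
  interpret fd_algebra scale by (rule assms(1))
  interpret split_basic_nilpotent_algebra scale e t n i j
    by unfold_locales (use assms in auto)
  obtain \<Phi> where bij: "bij_betw \<Phi> (terminal_fibre scale e t n i j) (proj_space (dual_space scale V))"
    and \<Phi>: "\<And>\<phi>. \<phi> \<in> dual_space scale V \<Longrightarrow> \<phi> \<noteq> 0 \<Longrightarrow> \<Phi> (iso_class (M \<phi>)) = fun_space.span {\<phi>}"
    using terminal_fibre_bij_betw by blast
  have coords: "bij_betw (\<lambda>C. dual_coords m b ` \<Phi> C) (terminal_fibre scale e t n i j)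
      (proj_space (coord_space m :: (nat \<Rightarrow> 'k) set))" if b: "is_basis scale V m b" for b
  proof -
    have "bij_betw (\<lambda>L. dual_coords m b ` L) (proj_space (dual_space scale V))
        (proj_space (coord_space m :: (nat \<Rightarrow> 'k) set))"
      by (rule proj_space_bij_betw[OF subspace_dual_space subspace_coord_space dual_coords_bij_betw[OF b]])
        (auto simp: dual_coords_def fun_scale_def)
    from bij_betw_trans[OF bij this] show ?thesis by (simp add: comp_def)
  qed
  have "\<exists>b. is_basis scale V m b"
    unfolding assms(10) by (rule is_basis_exists[OF subspace_V_space])
  then show ?thesis using bij \<Phi> coords by blast
qed

end
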